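(* Let $f:[0,\infty)\to(0,\infty)$ be a differentiable mapping and let $a,b\in[0,\infty)$ with $a<b$. Let $(\alpha,m)\in(0,1]\times(0,1]$ and $\mu>0$. Suppose that $f'\in L[a,b]$, that $|f'|$ is $(\alpha,m)$-logarithmically convex, and that $|f'(x)|\le M$. Then for every $x\in[a,b]$, $$\left|\frac{(x-a)^{\mu}+(b-x)^{\mu}}{b-a}f(x)-\frac{\Gamma(\mu+1)}{b-a}\left[J_{x^-}^{\mu}f(a)+J_{x^+}^{\mu}f(b)\right]\right|\le\left[\frac{1}{2\mu+1}+K_1\right]\left[\frac{(x-a)^{\mu+1}+(b-x)^{\mu+1}}{2(b-a)}\right],$$ where $$K_1=\begin{cases}\dfrac{M^{2m}\left(M^{2\alpha-2\alpha m}-1\right)}{(2\alpha-2\alpha m)\ln M}, & M<1,\\[2mm] 1, & M=1.\end{cases}$$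
   Context: For $(\alpha,m)\in(0,1]\times(0,1]$, a function $g:[0,\infty)\to(0,\infty)$ is $(\alpha,m)$-logarithmically convex if $g(tx+m(1-t)y)\le [g(x)]^{t^{\alpha}}[g(y)]^{m(1-t^{\alpha})}$ for all $x,y\in[0,\infty)$ and $t\in[0,1]$. $M$ is a constant, and the bound $|f'(x)|\le M$ is meant for all $x\in[0,\infty)$. Riemann-Liouville fractional integrals of order $\mu>0$: $J_{x^-}^{\mu}f(a)=\frac{1}{\Gamma(\mu)}\int_a^x (t-a)^{\mu-1}f(t)\,dt$ and $J_{x^+}^{\mu}f(b)=\frac{1}{\Gamma(\mu)}\int_x^b (b-t)^{\mu-1}f(t)\,dt$, where $\Gamma$ is the Gamma function. $L[a,b]$ denotes the Lebesgue integrable functions on $[a,b]$.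
   Formalization: For m = 1 and M < 1 the displayed formula for K_1 reads 0/0; there K_1 is taken to be its limit M^2 as m → 1. All other cases are as stated, with M ≤ 1, where K_1 is defined. *)

theory Defs
  imports "HOL-Analysis.Analysis"
begin

text \<open>
  Functions on \<open>[0,\<infinity>)\<close> are total functions on \<^typ>\<open>real\<close> of which only the values at
  non-negative arguments matter.
\<close>

definition log_convex_am :: "real \<Rightarrow> real \<Rightarrow> (real \<Rightarrow> real) \<Rightarrow> bool" where
  "log_convex_am \<alpha> m g \<longleftrightarrow>
     (\<forall>x\<ge>0. g x > 0) \<and>
     (\<forall>x\<ge>0. \<forall>y\<ge>0. \<forall>t\<in>{0..1}.
        g (t * x + m * (1 - t) * y) \<le> g x powr (t powr \<alpha>) * g y powr (m * (1 - t powr \<alpha>)))"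

text \<open>
  The point at which the fractional integral is evaluated is the last argument:
  \<open>RL_minus x \<mu> f a\<close> is $J_{x^-}^{\mu} f(a)$ and \<open>RL_plus x \<mu> f b\<close> is $J_{x^+}^{\mu} f(b)$.
  For \<open>\<mu> < 1\<close> the singular endpoint of the kernel is harmless: \<open>0 powr _ = 0\<close> there, and a
  single point is a null set.
\<close>

definition RL_minus :: "real \<Rightarrow> real \<Rightarrow> (real \<Rightarrow> real) \<Rightarrow> real \<Rightarrow> real" where
  "RL_minus x \<mu> f a =
     1 / Gamma \<mu> * set_lebesgue_integral lebesgue {a..x} (\<lambda>t. (t - a) powr (\<mu> - 1) * f t)"

definition RL_plus :: "real \<Rightarrow> real \<Rightarrow> (real \<Rightarrow> real) \<Rightarrow> real \<Rightarrow> real" where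
  "RL_plus x \<mu> f b =
     1 / Gamma \<mu> * set_lebesgue_integral lebesgue {x..b} (\<lambda>t. (b - t) powr (\<mu> - 1) * f t)"

text \<open>
  The constant is only meant for \<open>0 < M \<le> 1\<close>.  For \<open>m = 1\<close> and \<open>M < 1\<close> the quotient reads
  \<open>0 / 0\<close> and is understood as its limit \<open>M\<^sup>2\<close> for \<open>m \<rightarrow> 1\<close> (see \<open>K1_tendsto\<close> below); the
  junk value \<open>0\<close> of the division would be wrong.
\<close>

definition K1 :: "real \<Rightarrow> real \<Rightarrow> real \<Rightarrow> real" where
  "K1 \<alpha> m M =
     (if M = 1 then 1
      else if m = 1 then M\<^sup>2
      else M powr (2 * m) * (M powr (2 * \<alpha> - 2 * \<alpha> * m) - 1) / ((2 * \<alpha> - 2 * \<alpha> * m) * ln M))"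

lemma K1_tendsto:
  assumes "0 < \<alpha>" "0 < M" "M < 1"
  shows "((\<lambda>m. K1 \<alpha> m M) \<longlongrightarrow> K1 \<alpha> 1 M) (at 1)"
proof -
  define c where "c = 2 * \<alpha> * ln M"
  have c: "c \<noteq> 0"
    using assms by (simp add: c_def)
  have "((\<lambda>h. exp (h * c)) has_real_derivative c) (at 0)"
    by (auto intro!: derivative_eq_intros)
  then have "((\<lambda>h. (exp (h * c) - 1) / h) \<longlongrightarrow> c) (at 0)"
    by (simp add: has_field_derivative_iff)
  moreover have "filterlim (\<lambda>m::real. 1 - m) (at 0) (at 1)"
    by (auto simp: filterlim_at eventually_neq_at_within intro!: tendsto_eq_intros)
  ultimately have "((\<lambda>m. (exp ((1 - m) * c) - 1) / (1 - m)) \<longlongrightarrow> c) (at 1)"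
    by (rule filterlim_compose)
  then have "((\<lambda>m. M powr (2 * m) * ((exp ((1 - m) * c) - 1) / (1 - m)) / c)
      \<longlongrightarrow> M powr (2 * 1) * c / c) (at 1)"
    using assms c by (intro tendsto_intros) auto
  moreover have "\<forall>\<^sub>F m in at 1. M powr (2 * m) * ((exp ((1 - m) * c) - 1) / (1 - m)) / c = K1 \<alpha> m M"
  proof (rule eventually_mono[OF eventually_neq_at_within[of 1]])
    fix m :: real
    assume "m \<noteq> 1"
    have "M powr (2 * \<alpha> - 2 * \<alpha> * m) = exp ((1 - m) * c)"
      using assms(2) by (simp add: powr_def c_def left_diff_distrib right_diff_distrib mult.commute mult.left_commute)
    moreover have "(2 * \<alpha> - 2 * \<alpha> * m) * ln M = (1 - m) * c"
      by (simp add: c_def left_diff_distrib)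
    ultimately show "M powr (2 * m) * ((exp ((1 - m) * c) - 1) / (1 - m)) / c = K1 \<alpha> m M"
      using assms(3) \<open>m \<noteq> 1\<close> unfolding K1_def by simp
  qed
  moreover have "M powr (2 * 1) * c / c = K1 \<alpha> 1 M"
    using assms(2,3) c by (simp add: K1_def)
  ultimately show ?thesis
    by (simp add: Lim_transform_eventually)
qed

end

theory Submission
  imports Defs
begin

text \<open>
  Since \<open>\<mu> * \<integral>\<^sub>a\<^sup>x (t - a)\<^sup>\<mu>\<^sup>-\<^sup>1 dt = (x - a)\<^sup>\<mu>\<close>, the left half of the expression to be estimated is
  \<open>\<mu> * \<integral>\<^sub>a\<^sup>x (t - a)\<^sup>\<mu>\<^sup>-\<^sup>1 (f x - f t) dt\<close>.  By the mean value theorem \<open>\<bar>f x - f t\<bar> \<le> M (x - t)\<close>, so it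
  is at most \<open>M (x - a)\<^sup>\<mu>\<^sup>+\<^sup>1 / (\<mu> + 1)\<close>; the right half is its mirror image.  It remains to see that
  \<open>2 M / (\<mu> + 1) \<le> 1 / (2 \<mu> + 1) + K\<^sub>1\<close>, which follows from \<open>M\<^sup>2 \<le> K\<^sub>1\<close> and the AM-GM inequality
  because \<open>2 \<mu> + 1 \<le> (\<mu> + 1)\<^sup>2\<close>.
\<close>

text \<open>For \<open>s < 1\<close> the integrand is unbounded near \<open>a\<close>, but the
  antiderivative \<open>(t - a) powr s / s\<close> stays continuous there. Hence the fundamental
  theorem is used in its interior form.\<close>

lemma has_integral_powr_shift:
  fixes a x s :: real
  assumes "s > 0" "a \<le> x"
  shows "((\<lambda>t. (t - a) powr (s - 1)) has_integral (x - a) powr s / s) {a..x}"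
proof -
  have "((\<lambda>t. (t - a) powr (s - 1)) has_integral (x - a) powr s / s - (a - a) powr s / s) {a..x}"
  proof (rule fundamental_theorem_of_calculus_interior[OF assms(2)])
    show "continuous_on {a..x} (\<lambda>t. (t - a) powr s / s)"
      using assms by (intro continuous_intros continuous_on_powr') auto
    fix t assume "t \<in> {a<..<x}"
    then have "((\<lambda>t. (t - a) powr s / s) has_real_derivative (t - a) powr (s - 1)) (at t)"
      using assms by (auto intro!: derivative_eq_intros)
    then show "((\<lambda>t. (t - a) powr s / s) has_vector_derivative (t - a) powr (s - 1)) (at t)"
      by (simp add: has_real_derivative_iff_has_vector_derivative)
  qed
  then show ?thesis using assms by simp
qed

text \<open>An integrable nonnegative kernel times a bounded measurable function. This lets the
  Lebesgue integral in \<open>RL_minus\<close> be treated as a gauge integral.\<close>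

lemma absolutely_integrable_powr_shift_mult:
  fixes f :: "real \<Rightarrow> real"
  assumes "s > 0" "a \<le> x" "continuous_on {a..x} f"
  shows "(\<lambda>t. (t - a) powr (s - 1) * f t) absolutely_integrable_on {a..x}"
proof -
  have "(\<lambda>t. (t - a) powr (s - 1)) absolutely_integrable_on {a..x}"
    using has_integral_powr_shift[OF assms(1,2)]
    by (intro nonnegative_absolutely_integrable_1) (auto simp: integrable_on_def)
  moreover have "f \<in> borel_measurable (lebesgue_on {a..x})"
    using assms(3) by (intro continuous_imp_measurable_on_sets_lebesgue) auto
  moreover have "bounded (f ` {a..x})"
    using assms(3) by (intro compact_imp_bounded compact_continuous_image) auto
  ultimately have "(\<lambda>t. f t * (t - a) powr (s - 1)) absolutely_integrable_on {a..x}"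
    by (intro absolutely_integrable_bounded_measurable_product_real) auto
  then show ?thesis by (simp add: mult.commute)
qed

text \<open>Write \<open>x - t\<close> as \<open>(x - a) - (t - a)\<close> and integrate two pure
  powers.\<close>

lemma has_integral_powr_shift_mult_diff:
  fixes a x s :: real
  assumes "s > 0" "a \<le> x"
  shows "((\<lambda>t. (t - a) powr (s - 1) * (x - t)) has_integral (x - a) powr (s + 1) / (s * (s + 1))) {a..x}"
proof -
  have "((\<lambda>t. (x - a) * (t - a) powr (s - 1) - (t - a) powr (s + 1 - 1)) has_integral
      (x - a) * ((x - a) powr s / s) - (x - a) powr (s + 1) / (s + 1)) {a..x}"
    using assms by (intro has_integral_diff has_integral_mult_right has_integral_powr_shift) auto
  moreover have "(x - a) * (t - a) powr (s - 1) - (t - a) powr (s + 1 - 1) = (t - a) powr (s - 1) * (x - t)"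
    if "t \<in> {a..x}" for t
    \<comment> \<open>At \<open>t = a\<close> both sides vanish because
      \<open>0 powr _ = 0\<close>.\<close>
    using that by (cases "t = a") (auto simp: powr_diff field_simps)
  moreover have "(x - a) * ((x - a) powr s / s) - (x - a) powr (s + 1) / (s + 1)
      = (x - a) powr (s + 1) / (s * (s + 1))"
    using assms by (simp add: powr_add field_simps)
  ultimately show ?thesis
    by (smt (verit, best) has_integral_eq)
qed

text \<open>The bound \<open>lip\<close> is integrated against the kernel. It is assumed at the
  fixed point \<open>x\<close>, with no mention of a derivative, so that the lemma also applies to a
  reflected function.\<close>

lemma RL_minus_estimate:
  fixes f :: "real \<Rightarrow> real"
  assumes s: "s > 0" and ax: "a \<le> x" and f: "continuous_on {a..x} f"
    and lip: "\<And>t. t \<in> {a..x} \<Longrightarrow> \<bar>f x - f t\<bar> \<le> M * (x - t)"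
  shows "\<bar>(x - a) powr s * f x - Gamma (s + 1) * RL_minus x s f a\<bar> \<le> M * (x - a) powr (s + 1) / (s + 1)"
proof -
  let ?k = "\<lambda>t. (t - a) powr (s - 1)"
  let ?I = "integral {a..x} (\<lambda>t. ?k t * f t)"
  have abs_int: "(\<lambda>t. ?k t * f t) absolutely_integrable_on {a..x}"
    by (rule absolutely_integrable_powr_shift_mult[OF s ax f])
  \<comment> \<open>The recurrence cancels the normalising factor \<open>1 / Gamma s\<close> and
    leaves \<open>s\<close> times the plain integral.\<close>
  have "Gamma (s + 1) = s * Gamma s" "Gamma s > 0"
    using s by (auto intro!: Gamma_plus1 Gamma_real_pos simp: nonpos_Ints_def)
  then have RL: "Gamma (s + 1) * RL_minus x s f a = s * ?I"
    using set_lebesgue_integral_eq_integral(2)[OF abs_int] by (simp add: RL_minus_def)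
  have J: "((\<lambda>t. ?k t * f x - ?k t * f t) has_integral (x - a) powr s / s * f x - ?I) {a..x}"
    using abs_int s ax
    by (intro has_integral_diff has_integral_mult_left has_integral_powr_shift integrable_integral
        set_lebesgue_integral_eq_integral(1)) auto
  have B: "((\<lambda>t. M * (?k t * (x - t))) has_integral M * ((x - a) powr (s + 1) / (s * (s + 1)))) {a..x}"
    by (intro has_integral_mult_right has_integral_powr_shift_mult_diff s ax)
  have "norm (integral {a..x} (\<lambda>t. ?k t * f x - ?k t * f t)) \<le> integral {a..x} (\<lambda>t. M * (?k t * (x - t)))"
  proof (rule integral_norm_bound_integral)
    fix t assume "t \<in> {a..x}"
    then have "?k t * \<bar>f x - f t\<bar> \<le> ?k t * (M * (x - t))"
      by (intro mult_left_mono lip) auto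
    then show "norm (?k t * f x - ?k t * f t) \<le> M * (?k t * (x - t))"
      by (simp add: abs_mult mult.left_commute flip: right_diff_distrib)
  qed (use J B in \<open>auto simp: integrable_on_def\<close>)
  then have "\<bar>(x - a) powr s / s * f x - ?I\<bar> \<le> M * ((x - a) powr (s + 1) / (s * (s + 1)))"
    by (simp only: integral_unique[OF J] integral_unique[OF B] real_norm_def)
  then have "s * \<bar>(x - a) powr s / s * f x - ?I\<bar> \<le> s * (M * ((x - a) powr (s + 1) / (s * (s + 1))))"
    using s by (intro mult_left_mono) auto
  moreover have "s * \<bar>(x - a) powr s / s * f x - ?I\<bar> = \<bar>(x - a) powr s * f x - s * ?I\<bar>"
    using s by (simp add: abs_mult_pos' field_simps)
  ultimately show ?thesis
    using s RL by simp
qed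

text \<open>The substitution of \<open>- t\<close> for \<open>t\<close> turns the kernel base
  \<open>b - t\<close> into \<open>t - (- b)\<close>, so estimates for the right half follow from
  those for the left half.\<close>

lemma RL_plus_eq_RL_minus: "RL_plus x s f b = RL_minus (- x) s (\<lambda>t. f (- t)) (- b)"
proof -
  have set_integral: "set_lebesgue_integral lebesgue {c..d} g = integral\<^sup>L (lebesgue_on {c..d}) g"
    for c d :: real and g :: "real \<Rightarrow> real"
    by (simp add: set_lebesgue_integral_def integral_restrict_space)
  show ?thesis
    using integral_reflect_real[of b x "\<lambda>t. (b - t) powr (s - 1) * f t"]
    by (simp add: RL_plus_def RL_minus_def set_integral add.commute)
qed

lemma RL_plus_estimate:
  fixes f :: "real \<Rightarrow> real"
  assumes s: "s > 0" and xb: "x \<le> b" and f: "continuous_on {x..b} f"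
    and lip: "\<And>t. t \<in> {x..b} \<Longrightarrow> \<bar>f x - f t\<bar> \<le> M * (t - x)"
  shows "\<bar>(b - x) powr s * f x - Gamma (s + 1) * RL_plus x s f b\<bar> \<le> M * (b - x) powr (s + 1) / (s + 1)"
proof -
  have "continuous_on {- b..- x} (\<lambda>t. f (- t))"
    using f by (rule continuous_on_compose2) (auto intro!: continuous_intros)
  moreover have "\<bar>f (- (- x)) - f (- t)\<bar> \<le> M * (- x - t)" if "t \<in> {- b..- x}" for t
    using lip[of "- t"] that by (simp add: minus_diff_commute[of x t])
  ultimately have "\<bar>(- x - (- b)) powr s * f (- (- x)) - Gamma (s + 1) * RL_minus (- x) s (\<lambda>t. f (- t)) (- b)\<bar>
      \<le> M * (- x - (- b)) powr (s + 1) / (s + 1)"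
    using s xb by (intro RL_minus_estimate) auto
  then show ?thesis
    by (simp add: RL_plus_eq_RL_minus)
qed

text \<open>Away from the degenerate cases, where equality holds, \<open>K1\<close> is the mean of
  \<open>M powr (2 * m + c * t)\<close> over \<open>t\<close> in [0,1], with
  \<open>c = 2 * \<alpha> * (1 - m)\<close>. As \<open>M < 1\<close>, it is at least the value at
  \<open>t = 1\<close>, and there the exponent is at most 2.\<close>

lemma K1_ge_square:
  assumes "\<alpha> \<in> {0<..1}" "m \<in> {0<..1}" "0 < M" "M \<le> 1"
  shows "M\<^sup>2 \<le> K1 \<alpha> m M"
proof (cases "M = 1 \<or> m = 1")
  case True
  then show ?thesis by (auto simp: K1_def)
next
  case False
  define c where "c = 2 * \<alpha> - 2 * \<alpha> * m"
  have c: "c = 2 * (\<alpha> * (1 - m))" by (simp add: c_def algebra_simps)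
  have "\<alpha> * (1 - m) \<le> 1 * (1 - m)" using assms by (intro mult_right_mono) auto
  then have "2 * m + c \<le> 2" using c by simp
  have "c > 0" using assms False c by auto
  define y where "y = - (c * ln M)"
  have "ln M < 0" using assms False by simp
  then have y: "y > 0" using \<open>c > 0\<close> by (simp add: y_def mult_pos_neg)
  have Mc: "M powr c = exp (- y)" using assms by (simp add: powr_def y_def)
  \<comment> \<open>With \<open>M powr c = exp (- y)\<close> the quotient in \<open>K1\<close>
    becomes \<open>(1 - exp (- y)) / y\<close>; this inequality bounds it below by
    \<open>exp (- y)\<close>.\<close>
  have "1 + y \<le> exp y" by (rule exp_ge_add_one_self)
  then have "exp (- y) * (1 + y) \<le> exp (- y) * exp y" by (intro mult_left_mono) auto
  then have "exp (- y) * y \<le> 1 - exp (- y)" by (simp add: algebra_simps flip: exp_add)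
  then have "M powr c \<le> (1 - exp (- y)) / y" using y Mc by (simp add: field_simps)
  also have "(1 - exp (- y)) / y = (M powr c - 1) / (c * ln M)"
    using Mc y_def by (simp add: minus_divide_right diff_divide_distrib)
  finally have "M powr (2 * m) * M powr c \<le> M powr (2 * m) * ((M powr c - 1) / (c * ln M))"
    by (intro mult_left_mono) auto
  moreover have "M powr 2 \<le> M powr (2 * m + c)"
    using \<open>2 * m + c \<le> 2\<close> assms by (intro powr_mono') auto
  ultimately show ?thesis
    using assms False by (simp add: K1_def powr_add c_def)
qed

lemma two_mult_div_le:
  fixes s M :: real
  assumes "s > 0" "M \<ge> 0"
  shows "2 * M / (s + 1) \<le> 1 / (2 * s + 1) + M\<^sup>2"
proof -
  \<comment> \<open>Chosen so that AM-GM for \<open>M\<close> and \<open>1 / r\<close> yields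
    exactly the right-hand side.\<close>
  define r where "r = sqrt (2 * s + 1)"
  have r: "r > 0" "r\<^sup>2 = 2 * s + 1" using assms by (auto simp: r_def)
  have "r \<le> s + 1"
    using assms unfolding r_def by (intro real_le_lsqrt) (auto simp: power2_eq_square algebra_simps)
  then have "2 * M / (s + 1) \<le> 2 * M / r"
    using assms r by (intro divide_left_mono) auto
  also have "\<dots> \<le> 1 / r\<^sup>2 + M\<^sup>2"
    using sum_squares_bound[of M "1 / r"] by (simp add: power_divide)
  finally show ?thesis using r by simp
qed

theorem theorem1:
  fixes f f' :: "real \<Rightarrow> real" and a b \<alpha> m \<mu> M x :: real
  assumes "\<forall>u\<ge>0. f u > 0"
    and "\<forall>u\<ge>0. (f has_real_derivative f' u) (at u within {0..})"
    and "0 \<le> a" and "a < b"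
    and "\<alpha> \<in> {0<..1}" and "m \<in> {0<..1}" and "\<mu> > 0"
    and "f' absolutely_integrable_on {a..b}"
    and "log_convex_am \<alpha> m (\<lambda>u. \<bar>f' u\<bar>)"
    and "\<forall>u\<ge>0. \<bar>f' u\<bar> \<le> M"
    and "M \<le> 1"
    and "x \<in> {a..b}"
  shows "\<bar>((x - a) powr \<mu> + (b - x) powr \<mu>) / (b - a) * f x
           - Gamma (\<mu> + 1) / (b - a) * (RL_minus x \<mu> f a + RL_plus x \<mu> f b)\<bar>
         \<le> (1 / (2 * \<mu> + 1) + K1 \<alpha> m M)
             * (((x - a) powr (\<mu> + 1) + (b - x) powr (\<mu> + 1)) / (2 * (b - a)))"
proof -
  \<comment> \<open>Logarithmic convexity includes positivity of \<open>\<bar>f' u\<bar>\<close>,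
    which forces \<open>M > 0\<close> and makes \<open>ln M\<close> meaningful.\<close>
  have "0 < \<bar>f' 0\<bar>" "\<bar>f' 0\<bar> \<le> M"
    using assms(9,10) by (auto simp: log_convex_am_def)
  then have M: "0 < M" by linarith
  have cont: "continuous_on {0..} f"
    using assms(2) by (auto simp: continuous_on_eq_continuous_within intro!: DERIV_continuous)
  \<comment> \<open>Mean value inequality on the convex set \<open>{0..}\<close>, with a one-sided
    derivative at 0.\<close>
  have lip: "\<bar>f u - f v\<bar> \<le> M * \<bar>u - v\<bar>" if "u \<ge> 0" "v \<ge> 0" for u v
    using field_differentiable_bound[of "{0..}" f f' M u v] assms(2,10) that by auto
  let ?P = "(x - a) powr (\<mu> + 1)" and ?Q = "(b - x) powr (\<mu> + 1)"
  let ?A = "(x - a) powr \<mu> * f x - Gamma (\<mu> + 1) * RL_minus x \<mu> f a"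
  let ?B = "(b - x) powr \<mu> * f x - Gamma (\<mu> + 1) * RL_plus x \<mu> f b"
  have A: "\<bar>?A\<bar> \<le> M * ?P / (\<mu> + 1)"
  proof (rule RL_minus_estimate)
    show "\<bar>f x - f t\<bar> \<le> M * (x - t)" if "t \<in> {a..x}" for t
      using lip[of x t] that assms(3) by auto
  qed (use assms in \<open>auto intro: continuous_on_subset[OF cont]\<close>)
  have B: "\<bar>?B\<bar> \<le> M * ?Q / (\<mu> + 1)"
  proof (rule RL_plus_estimate)
    show "\<bar>f x - f t\<bar> \<le> M * (t - x)" if "t \<in> {x..b}" for t
      using lip[of x t] that assms(3,12) by auto
  qed (use assms in \<open>auto intro: continuous_on_subset[OF cont]\<close>)
  have K: "2 * M / (\<mu> + 1) \<le> 1 / (2 * \<mu> + 1) + K1 \<alpha> m M"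
    using two_mult_div_le[of \<mu> M] K1_ge_square[of \<alpha> m M] assms M by auto
  have "((x - a) powr \<mu> + (b - x) powr \<mu>) / (b - a) * f x
      - Gamma (\<mu> + 1) / (b - a) * (RL_minus x \<mu> f a + RL_plus x \<mu> f b) = (?A + ?B) / (b - a)"
    by (simp add: diff_divide_distrib add_divide_distrib algebra_simps)
  also have "\<bar>\<dots>\<bar> = \<bar>?A + ?B\<bar> / (b - a)"
    using assms(4) by simp
  also have "\<dots> \<le> (M * ?P / (\<mu> + 1) + M * ?Q / (\<mu> + 1)) / (b - a)"
    using A B assms(4) by (intro divide_right_mono) auto
  \<comment> \<open>The factor 2 is inserted to match the denominator \<open>2 * (b - a)\<close> of
    the claim.\<close>
  also have "\<dots> = 2 * M / (\<mu> + 1) * ((?P + ?Q) / (2 * (b - a)))"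
    by (simp del: right_diff_distrib_numeral flip: add_divide_distrib distrib_left)
  also have "\<dots> \<le> (1 / (2 * \<mu> + 1) + K1 \<alpha> m M) * ((?P + ?Q) / (2 * (b - a)))"
    using assms(4) by (intro mult_right_mono K) auto
  finally show ?thesis .
qed

end
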